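(* Let $k$ be a positive real number. The falling $k$-binomial transform $(f_{k,n})_{n\ge 0}$ of the modified $k$-Fibonacci-like sequence satisfies the recurrence relation $$f_{k,n+1} = 3k\,f_{k,n} - (2k^{2}-1)\,f_{k,n-1}\quad\text{for all integers } n\ge 1,$$ with the initial conditions $f_{k,0}=2$ and $f_{k,1}=2k+2$.
   Context: For a positive real number $k$, the modified $k$-Fibonacci-like sequence $(M_{k,n})_{n\ge 0}$ is defined by $M_{k,0}=M_{k,1}=2$ and $M_{k,n+1}=kM_{k,n}+M_{k,n-1}$ for $n\ge 1$. Its falling $k$-binomial transform $(f_{k,n})_{n\ge 0}$ is defined by $f_{k,n}=\sum_{i=0}^{n}\binom{n}{i}k^{n-i}M_{k,i}$. *)

theory Defs
  imports Complex_Main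
begin

fun mod_fib_like :: "real \<Rightarrow> nat \<Rightarrow> real" where
  "mod_fib_like k 0 = 2"
| "mod_fib_like k (Suc 0) = 2"
| "mod_fib_like k (Suc (Suc n)) = k * mod_fib_like k (Suc n) + mod_fib_like k n"

definition falling_binomial_transform :: "real \<Rightarrow> (nat \<Rightarrow> real) \<Rightarrow> nat \<Rightarrow> real" where
  "falling_binomial_transform k a n = (\<Sum>i=0..n. real (n choose i) * k ^ (n - i) * a i)"

end

theory Submission
  imports Defs
begin

text \<open>
  Let \<open>E\<close> be the shift operator on sequences. The transform of \<open>a\<close> at \<open>n\<close> is the value at \<open>0\<close>
  of \<open>(k + E)\<^sup>n a\<close>, by the binomial theorem. The sequence \<open>M\<close> is annihilated by
  \<open>E\<^sup>2 - k E - 1\<close>, and modulo this polynomial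
  \<open>(k + E)\<^sup>2 = k\<^sup>2 + 3 k E + 1 = 3 k (k + E) - (2 k\<^sup>2 - 1)\<close>.
  Multiplying by \<open>(k + E)\<^bsup>n-1\<^esup>\<close> gives the claimed recurrence.

  The operator identity \<open>(k + E)\<^bsup>n+1\<^esup> = (k + E)\<^sup>n (k + E)\<close> appears below as the lemma
  \<open>falling_binomial_transform_Suc\<close>. Together with linearity of the transform it is all that is
  needed, so the recurrence is proved for every sequence that satisfies the recurrence of \<open>M\<close>.
\<close>

lemma falling_binomial_transform_add:
  "falling_binomial_transform k (\<lambda>i. a i + b i) n =
   falling_binomial_transform k a n + falling_binomial_transform k b n"
  by (simp add: falling_binomial_transform_def distrib_left sum.distrib)

lemma falling_binomial_transform_mult:
  "falling_binomial_transform k (\<lambda>i. c * a i) n = c * falling_binomial_transform k a n"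
  by (simp add: falling_binomial_transform_def sum_distrib_left mult_ac)

text \<open>
  Pascal's rule splits each term of index \<open>i + 1\<close> in two: the part with \<open>n choose i\<close> belongs to
  the transform of the shifted sequence, and the part with \<open>n choose (i + 1)\<close>, together with the
  term of index \<open>0\<close>, is \<open>k\<close> times the transform of the sequence itself.
\<close>

lemma falling_binomial_transform_Suc:
  "falling_binomial_transform k a (Suc n) =
   k * falling_binomial_transform k a n + falling_binomial_transform k (\<lambda>i. a (Suc i)) n"
proof -
  let ?t = "\<lambda>i. real (n choose i) * k ^ (Suc n - i) * a i"
  have "falling_binomial_transform k a (Suc n) =
      k ^ Suc n * a 0 + (\<Sum>i=0..n. real (Suc n choose Suc i) * k ^ (n - i) * a (Suc i))"
    unfolding falling_binomial_transform_def
    by (subst sum.atLeast0_atMost_Suc_shift) simp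
  also have "\<dots> = (?t 0 + (\<Sum>i=0..n. ?t (Suc i)))
      + falling_binomial_transform k (\<lambda>i. a (Suc i)) n"
    by (simp add: falling_binomial_transform_def distrib_right sum.distrib)
  also have "?t 0 + (\<Sum>i=0..n. ?t (Suc i)) = (\<Sum>i=0..Suc n. ?t i)"
    by (subst sum.atLeast0_atMost_Suc_shift) simp
  \<comment> \<open>The last term vanishes because \<open>n choose (n + 1) = 0\<close>.\<close>
  also have "\<dots> = (\<Sum>i=0..n. ?t i)"
    by simp
  also have "\<dots> = k * falling_binomial_transform k a n"
    unfolding falling_binomial_transform_def sum_distrib_left
    by (intro sum.cong refl) (simp add: Suc_diff_le)
  finally show ?thesis .
qed

lemma falling_binomial_transform_recurrence:
  assumes "\<And>i. a (Suc (Suc i)) = k * a (Suc i) + a i"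
  shows "falling_binomial_transform k a (Suc (Suc n)) =
    3 * k * falling_binomial_transform k a (Suc n)
    - (2 * k\<^sup>2 - 1) * falling_binomial_transform k a n"
proof -
  let ?T = "falling_binomial_transform k"
  let ?b = "\<lambda>i. a (Suc i)"
  have shift2: "?T (\<lambda>i. a (Suc (Suc i))) n = k * ?T ?b n + ?T a n"
    by (simp add: assms falling_binomial_transform_add falling_binomial_transform_mult)
  have "?T a (Suc (Suc n)) = k * ?T a (Suc n) + 2 * k * ?T ?b n + ?T a n"
    by (simp add: falling_binomial_transform_Suc[of k a "Suc n"]
        falling_binomial_transform_Suc[of k ?b n] shift2)
  moreover have "?T ?b n = ?T a (Suc n) - k * ?T a n"
    by (simp add: falling_binomial_transform_Suc)
  ultimately show ?thesis
    by (simp add: algebra_simps power2_eq_square)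
qed

theorem theorem12:
  fixes k :: real and f :: "nat \<Rightarrow> real"
  assumes "k > 0"
  defines "f \<equiv> falling_binomial_transform k (mod_fib_like k)"
  shows "(\<forall>n\<ge>1. f (n + 1) = 3 * k * f n - (2 * k\<^sup>2 - 1) * f (n - 1)) \<and> f 0 = 2 \<and> f 1 = 2 * k + 2"
proof (intro conjI allI impI)
  fix n :: nat
  assume "n \<ge> 1"
  then obtain m where "n = Suc m"
    by (cases n) auto
  then show "f (n + 1) = 3 * k * f n - (2 * k\<^sup>2 - 1) * f (n - 1)"
    using falling_binomial_transform_recurrence[of "mod_fib_like k" k m]
    by (simp add: f_def)
next
  show "f 0 = 2" "f 1 = 2 * k + 2"
    by (simp_all add: f_def falling_binomial_transform_def)
qed

end
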